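(* Every separable permutation $\sigma=\sigma_1\cdots\sigma_n$ of length $n\ge2$ has at least one index $i$ with $|\sigma_i-\sigma_{i+1}|=1$ or $|\sigma_{i-1}-\sigma_i|=1$ (ignoring nonexistent entries). That is, apart from the empty permutation and the permutation $1$, no separable permutation avoids the 1-box pattern.
   Context: A permutation is separable if it avoids both patterns $2413$ and $3142$, i.e., it has no subsequence $\sigma_{i_1}\sigma_{i_2}\sigma_{i_3}\sigma_{i_4}$ ($i_1<i_2<i_3<i_4$) order-isomorphic to $2413$ or to $3142$. An index $i$ as in the claim is called an occurrence of the 1-box pattern. *)

theory Defs
  imports "HOL-Combinatorics.Multiset_Permutations" "HOL-Library.Sublist"
begin

text \<open>
  A permutation of length \<open>n\<close> is written in one-line notation, as a list in
  \<open>permutations_of_set {1..n}\<close>. Positions are counted from 0, as usual for lists,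
  whereas the entries are \<open>1, \<dots>, n\<close>.
\<close>

definition order_isomorphic :: "nat list \<Rightarrow> nat list \<Rightarrow> bool" where
  "order_isomorphic xs ys \<longleftrightarrow>
     length xs = length ys \<and>
     (\<forall>i < length xs. \<forall>j < length xs. xs ! i < xs ! j \<longleftrightarrow> ys ! i < ys ! j)"

definition avoids_pattern :: "nat list \<Rightarrow> nat list \<Rightarrow> bool" where
  "avoids_pattern \<sigma> p \<longleftrightarrow> \<not> (\<exists>xs. subseq xs \<sigma> \<and> order_isomorphic xs p)"

definition separable :: "nat list \<Rightarrow> bool" where
  "separable \<sigma> \<longleftrightarrow> avoids_pattern \<sigma> [2, 4, 1, 3] \<and> avoids_pattern \<sigma> [3, 1, 4, 2]"

text \<open>The entries are cast to integers, since subtraction on naturals truncates.\<close>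

definition one_box_occurrence :: "nat list \<Rightarrow> nat \<Rightarrow> bool" where
  "one_box_occurrence \<sigma> i \<longleftrightarrow>
     i < length \<sigma> \<and>
     (i + 1 < length \<sigma> \<and> \<bar>int (\<sigma> ! i) - int (\<sigma> ! (i + 1))\<bar> = 1 \<or>
      0 < i \<and> \<bar>int (\<sigma> ! (i - 1)) - int (\<sigma> ! i)\<bar> = 1)"

definition avoids_one_box :: "nat list \<Rightarrow> bool" where
  "avoids_one_box \<sigma> \<longleftrightarrow> \<not> (\<exists>i. one_box_occurrence \<sigma> i)"

end

theory Submission
  imports Defs
begin

text \<open>
  A separable permutation of length at least 2 splits as \<open>as @ bs\<close> with all entries of \<open>as\<close>
  below, or all above, those of \<open>bs\<close>. This follows by appending the entries one at a time: if
  the new entry \<open>v\<close> destroys the split of the old entries with shortest \<open>as\<close>, then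
  two entries of \<open>as\<close>, one of \<open>bs\<close> and \<open>v\<close> form a forbidden pattern. Both parts again have an
  interval as their set of entries, so repeated splitting ends in two
  neighbouring entries with consecutive values.
\<close>

text \<open>For \<open>(<)\<close> this is a direct sum decomposition, for \<open>(>)\<close> a skew
  sum; the relation is a parameter so that one argument covers both.\<close>

definition splits :: "('a \<Rightarrow> 'a \<Rightarrow> bool) \<Rightarrow> 'a list \<Rightarrow> bool" where
  "splits R xs \<longleftrightarrow>
     (\<exists>as bs. xs = as @ bs \<and> as \<noteq> [] \<and> bs \<noteq> [] \<and> (\<forall>a\<in>set as. \<forall>b\<in>set bs. R a b))"

lemma splitsI:
  "xs = as @ bs \<Longrightarrow> as \<noteq> [] \<Longrightarrow> bs \<noteq> [] \<Longrightarrow> (\<And>a b. a \<in> set as \<Longrightarrow> b \<in> set bs \<Longrightarrow> R a b) \<Longrightarrow> splits R xs"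
  unfolding splits_def by blast

text \<open>For \<open>R = (<)\<close> this is the pattern 3142, and for \<open>R = (>)\<close> it is 2413.\<close>

definition contains_3142 :: "('a \<Rightarrow> 'a \<Rightarrow> bool) \<Rightarrow> 'a list \<Rightarrow> bool" where
  "contains_3142 R xs \<longleftrightarrow> (\<exists>a b c d. R a b \<and> R b c \<and> R c d \<and> subseq [c, a, d, b] xs)"

lemma contains_3142_subseq:
  "contains_3142 R xs \<Longrightarrow> subseq xs ys \<Longrightarrow> contains_3142 R ys"
  unfolding contains_3142_def by (meson subseq_order.trans)

text \<open>Read \<open>R\<close> as "below". If \<open>v\<close> is above the whole first block, it
  joins the second one. Otherwise minimality of the first block and avoidance force \<open>v\<close>
  below every entry, so \<open>v\<close> forms a block by itself, with the order reversed.\<close>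

lemma splits_snoc:
  assumes "transp R" and "totalp R"
    and "splits R xs" and "v \<notin> set xs" and avoid: "\<not> contains_3142 R (xs @ [v])"
  shows "splits R (xs @ [v]) \<or> splits R\<inverse>\<inverse> (xs @ [v])"
proof -
  define P where "P as \<longleftrightarrow> (\<exists>bs. xs = as @ bs \<and> as \<noteq> [] \<and> bs \<noteq> [] \<and>
    (\<forall>a\<in>set as. \<forall>b\<in>set bs. R a b))" for as
  have "\<exists>as. P as" using \<open>splits R xs\<close> unfolding splits_def P_def by blast
  \<comment> \<open>A shortest first block cannot be cut further; this is what rules out a nonempty
    \<open>lo\<close>.\<close>
  then obtain as where "P as" and least: "\<And>cs. P cs \<Longrightarrow> length as \<le> length cs"
    using ex_has_least_nat[of P _ length] by blast
  then obtain bs where xs: "xs = as @ bs" and ne: "as \<noteq> []" "bs \<noteq> []"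
    and R: "\<And>a b. a \<in> set as \<Longrightarrow> b \<in> set bs \<Longrightarrow> R a b"
    unfolding P_def by blast
  have trans: "R x y \<Longrightarrow> R y z \<Longrightarrow> R x z" for x y z
    using \<open>transp R\<close> by (rule transpD)
  have above: "R v x" if "x \<in> set as" "\<not> R x v" for x
    using that totalpD[OF \<open>totalp R\<close>, of x v] \<open>v \<notin> set xs\<close> xs by auto
  define lo hi where "lo = takeWhile (\<lambda>x. R x v) as" and "hi = dropWhile (\<lambda>x. R x v) as"
  have as: "as = lo @ hi" by (simp add: lo_def hi_def)
  have lo: "R x v" if "x \<in> set lo" for x
    using that set_takeWhileD unfolding lo_def by fastforce
  show ?thesis
  proof (cases hi)
    case Nil
    then have "splits R (xs @ [v])"
      using xs ne R as lo by (intro splitsI[of _ as "bs @ [v]"]) auto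
    then show ?thesis ..
  next
    case (Cons h hs)
    have "\<not> R h v"
      using hd_dropWhile[of "\<lambda>x. R x v" as] Cons unfolding hi_def by auto
    then have h: "R v h" using above as Cons by simp
    have hi: "R v l" if "l \<in> set hi" for l
    proof (rule ccontr)
      assume "\<not> R v l"
      then have "R l v" using above that as by auto
      then have "l \<in> set hs" using that Cons \<open>\<not> R h v\<close> by auto
      obtain b where "b \<in> set bs" using ne by (cases bs) auto
      \<comment> \<open>Along \<open>R\<close> the chain is \<open>l\<close>, \<open>v\<close>,
        \<open>h\<close>, \<open>b\<close>, so \<open>h\<close>, \<open>l\<close>, \<open>b\<close>,
        \<open>v\<close> is the pattern. The leading empty list is matched with
        \<open>lo\<close>.\<close>
      have "subseq ([] @ [h] @ [l] @ [b] @ [v]) (lo @ [h] @ hs @ bs @ [v])"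
        using \<open>l \<in> set hs\<close> \<open>b \<in> set bs\<close>
        by (intro list_emb_append_mono) (auto simp: subseq_singleton_left)
      then have "subseq [h, l, b, v] (xs @ [v])" using xs as Cons by simp
      moreover have "R h b" using R as Cons \<open>b \<in> set bs\<close> by simp
      ultimately show False
        using avoid \<open>R l v\<close> h unfolding contains_3142_def by blast
    qed
    have "lo = []"
    proof (rule ccontr)
      assume "lo \<noteq> []"
      have "R a b" if "a \<in> set lo" "b \<in> set hi" for a b
        using trans[OF lo hi] that .
      \<comment> \<open>Entries of \<open>lo\<close> are below those of \<open>hi\<close> by way of
        \<open>v\<close>, so the cut can be moved to the end of \<open>lo\<close>.\<close>
      then have "P lo" unfolding P_def
        using \<open>lo \<noteq> []\<close> xs as ne R by (intro exI[of _ "hi @ bs"]) auto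
      from least[OF this] show False using as Cons by simp
    qed
    moreover have "R v b" if "b \<in> set bs" for b
      using trans[OF h, of b] R[of h b] that as Cons by simp
    ultimately have "splits R\<inverse>\<inverse> (xs @ [v])"
      using xs ne hi as by (intro splitsI[of _ xs "[v]"]) auto
    then show ?thesis ..
  qed
qed

text \<open>Induction by appending entries, starting from two. The step works from either kind of
  split, since each order is the converse of the other.\<close>

lemma splits_if_avoids:
  fixes xs :: "'a::linorder list"
  assumes "2 \<le> length xs" "distinct xs" "\<not> contains_3142 (<) xs" "\<not> contains_3142 (>) xs"
  shows "splits (<) xs \<or> splits (>) xs"
  using assms
proof (induction xs rule: rev_induct)
  case (snoc v xs)
  have conv: "(<)\<inverse>\<inverse> = ((>) :: 'a \<Rightarrow> 'a \<Rightarrow> bool)" "(>)\<inverse>\<inverse> = ((<) :: 'a \<Rightarrow> 'a \<Rightarrow> bool)"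
    by auto
  show ?case
  proof (cases "length xs = 1")
    case True
    then obtain u where "xs = [u]" by (auto simp: length_Suc_conv)
    then have pair: "splits R (xs @ [v])" if "R u v" for R
      using that by (intro splitsI[of _ "[u]" "[v]"]) auto
    have "u < v \<or> u > v" using snoc.prems(2) \<open>xs = [u]\<close> by auto
    then show ?thesis using pair[of "(<)"] pair[of "(>)"] by argo
  next
    case False
    have "subseq xs (xs @ [v])" by (intro subseq_rev_drop_many) simp
    then have "splits (<) xs \<or> splits (>) xs"
      using snoc False by (intro snoc.IH) (auto dest: contains_3142_subseq)
    then show ?thesis
      using splits_snoc[of "(<)" xs v] splits_snoc[of "(>)" xs v] snoc.prems
      unfolding conv by auto
  qed
qed simp

text \<open>A block with at least two entries is shorter and inherits all hypotheses. Convexity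
  replaces \<open>{1..n}\<close> because the values in a block need not start at 1.\<close>

lemma adjacent_consecutive_if_avoids:
  fixes xs :: "nat list"
  assumes "2 \<le> length xs" "distinct xs" "\<not> contains_3142 (<) xs" "\<not> contains_3142 (>) xs"
    and "\<And>a b c. a \<in> set xs \<Longrightarrow> c \<in> set xs \<Longrightarrow> a \<le> b \<Longrightarrow> b \<le> c \<Longrightarrow> b \<in> set xs"
  shows "\<exists>ps x y qs. xs = ps @ x # y # qs \<and> (y = Suc x \<or> x = Suc y)"
  using assms
proof (induction xs rule: length_induct)
  case (1 xs)
  note convex = "1.prems"(5)
  show ?case
  proof (cases "length xs = 2")
    case True
    then obtain x y where xs: "xs = [x, y]" by (auto simp: numeral_2_eq_2 length_Suc_conv)
    \<comment> \<open>The successor of the smaller entry lies between the two, so by convexity it is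
      the larger one.\<close>
    then have "y = Suc x \<or> x = Suc y"
      using "1.prems"(2) convex[of x y "Suc x"] convex[of y x "Suc y"] by fastforce
    then show ?thesis using xs by blast
  next
    case False
    obtain as bs where xs: "xs = as @ bs" and ne: "as \<noteq> []" "bs \<noteq> []"
      and R: "(\<forall>a\<in>set as. \<forall>b\<in>set bs. a < b) \<or> (\<forall>a\<in>set as. \<forall>b\<in>set bs. a > b)"
      using splits_if_avoids[of xs] "1.prems" unfolding splits_def by blast
    have part: "\<exists>ps x y qs. cs = ps @ x # y # qs \<and> (y = Suc x \<or> x = Suc y)"
      if "cs = as \<or> cs = bs" "2 \<le> length cs" for cs
    proof (rule "1.IH"[rule_format])
      show "length cs < length xs" using that xs ne by auto
      show "distinct cs" using that "1.prems"(2) xs by auto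
      have "subseq cs xs"
        using that(1) xs by (metis subseq_drop_many subseq_rev_drop_many subseq_order.refl)
      then show "\<not> contains_3142 (<) cs" "\<not> contains_3142 (>) cs"
        using "1.prems"(3,4) contains_3142_subseq by blast+
      fix a b c assume "a \<in> set cs" "c \<in> set cs" "a \<le> b" "b \<le> c"
      moreover from this have "b \<in> set xs"
        using convex[of a c b] that xs by auto
      \<comment> \<open>In the other block, \<open>b\<close> would be strictly below both
        \<open>a\<close> and \<open>c\<close> or strictly above both.\<close>
      ultimately show "b \<in> set cs" using that(1) R xs by (metis Un_iff leD set_append)
    qed (fact that)
    have "length xs > 2" using False "1.prems"(1) by simp
    then have "length as \<ge> 2 \<or> length bs \<ge> 2" using xs by auto
    then show ?thesis
    proof
      assume "length as \<ge> 2"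
      with part obtain ps x y qs where "as = ps @ x # y # qs" "y = Suc x \<or> x = Suc y" by blast
      then have "xs = ps @ x # y # (qs @ bs)" using xs by simp
      with \<open>y = Suc x \<or> x = Suc y\<close> show ?thesis by blast
    next
      assume "length bs \<ge> 2"
      with part obtain ps x y qs where "bs = ps @ x # y # qs" "y = Suc x \<or> x = Suc y" by blast
      then have "xs = (as @ ps) @ x # y # qs" using xs by simp
      with \<open>y = Suc x \<or> x = Suc y\<close> show ?thesis by blast
    qed
  qed
qed

lemma separable_not_contains:
  assumes "separable xs"
  shows "\<not> contains_3142 (<) xs" "\<not> contains_3142 (>) xs"
proof -
  have "order_isomorphic [c, a, d, b] [3, 1, 4, 2]" if "a < b" "b < c" "c < d" for a b c d :: nat
    using that by (auto simp: order_isomorphic_def nth_Cons' less_Suc_eq)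
  then show "\<not> contains_3142 (<) xs"
    using assms unfolding separable_def avoids_pattern_def contains_3142_def by blast
  \<comment> \<open>Reversing the order turns rank k into 5 - k, hence 3142 into 2413.\<close>
  have "order_isomorphic [c, a, d, b] [2, 4, 1, 3]" if "a > b" "b > c" "c > d" for a b c d :: nat
    using that by (auto simp: order_isomorphic_def nth_Cons' less_Suc_eq)
  then show "\<not> contains_3142 (>) xs"
    using assms unfolding separable_def avoids_pattern_def contains_3142_def by blast
qed

theorem theorem8:
  fixes \<sigma> :: "nat list" and n :: nat
  assumes "\<sigma> \<in> permutations_of_set {1..n}"
    and "separable \<sigma>"
  shows "(n \<ge> 2 \<longrightarrow> (\<exists>i. one_box_occurrence \<sigma> i)) \<and>
         (avoids_one_box \<sigma> \<longleftrightarrow> \<sigma> = [] \<or> \<sigma> = [1])"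
proof -
  have set: "set \<sigma> = {1..n}" and "distinct \<sigma>"
    using assms(1) by (auto simp: permutations_of_set_def)
  then have len: "length \<sigma> = n" using distinct_card[of \<sigma>] by simp
  have occ: "\<exists>i. one_box_occurrence \<sigma> i" if "n \<ge> 2"
  proof -
    have "\<exists>ps x y qs. \<sigma> = ps @ x # y # qs \<and> (y = Suc x \<or> x = Suc y)"
      using separable_not_contains[OF assms(2)] \<open>distinct \<sigma>\<close> len that set
      by (intro adjacent_consecutive_if_avoids) simp_all
    then obtain ps x y qs where "\<sigma> = ps @ x # y # qs" "y = Suc x \<or> x = Suc y" by blast
    \<comment> \<open>Counting from 0, \<open>length ps\<close> is the position of \<open>x\<close>,
      and \<open>y\<close> is its right neighbour.\<close>
    then have "one_box_occurrence \<sigma> (length ps)"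
      by (auto simp: one_box_occurrence_def nth_append)
    then show ?thesis ..
  qed
  have "\<sigma> = [] \<or> \<sigma> = [1]" if "n < 2"
  proof (cases "n = 0")
    case False
    with that have "n = 1" by simp
    with len obtain x where "\<sigma> = [x]" by (auto simp: length_Suc_conv)
    then show ?thesis using set \<open>n = 1\<close> by simp
  qed (use len in simp)
  moreover have "avoids_one_box []" "avoids_one_box [1]"
    by (auto simp: avoids_one_box_def one_box_occurrence_def)
  ultimately show ?thesis
    using occ unfolding avoids_one_box_def by (metis not_le)
qed

end
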